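(* For all integers $n\ge0$ and $p\ge1$, \[ \mathrm{Bel}_{n,\lambda}^{(p)}=p\sum_{m=0}^{n}\sum_{l=0}^{m}\binom{n}{m}\frac{(-1)^{l}}{p+l}S_{2,\lambda}(m,l)\,\mathrm{Bel}_{n-m,\lambda}. \]
   Context: Let $\lambda\in\mathbb{R}$. Set $(x)_{0,\lambda}=1$, $(x)_{n,\lambda}=x(x-\lambda)\cdots(x-(n-1)\lambda)$ for $n\ge1$; $(x)_0=1$, $(x)_n=x(x-1)\cdots(x-n+1)$. The degenerate exponential is the formal power series $e_\lambda^x(t)=\sum_{n\ge0}(x)_{n,\lambda}\frac{t^n}{n!}$ ($=(1+\lambda t)^{x/\lambda}$, and $e^{xt}$ if $\lambda=0$), $e_\lambda(t)=e_\lambda^1(t)$. The degenerate Stirling numbers of the second kind are defined by $(x)_{n,\lambda}=\sum_{k=0}^n S_{2,\lambda}(n,k)(x)_k$; equivalently $\frac{1}{k!}(e_\lambda(t)-1)^k=\sum_{n\ge k}S_{2,\lambda}(n,k)\frac{t^n}{n!}$. Degenerate Bell numbers: $e^{e_\lambda(t)-1}=\sum_{n\ge0}\mathrm{Bel}_{n,\lambda}\frac{t^n}{n!}$. For an integer $p\ge0$, the truncated degenerate Bell numbers $\mathrm{Bel}^{(p)}_{n,\lambda}$ are defined by $\sum_{n\ge0}\mathrm{Bel}^{(p)}_{n,\lambda}\frac{t^n}{n!}=\frac{p!}{(e_\lambda(t)-1)^p}\Big(e^{e_\lambda(t)-1}-\sum_{k=0}^{p-1}\frac{(e_\lambda(t)-1)^k}{k!}\Big)=p!\sum_{k\ge0}\frac{(e_\lambda(t)-1)^k}{(k+p)!}$.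 *)

theory Defs
  imports Complex_Main "HOL-Computational_Algebra.Formal_Power_Series"
begin

text \<open>
  The degenerate falling factorial \<open>(x)\<^sub>n\<^sub>,\<^sub>\<lambda> = x (x - \<lambda>) \<dots> (x - (n - 1) \<lambda>)\<close>.
  The ordinary falling factorial \<open>(x)\<^sub>n\<close> is the case \<open>\<lambda> = 1\<close>.
\<close>

definition deg_ffact :: "real \<Rightarrow> real \<Rightarrow> nat \<Rightarrow> real" where
  "deg_ffact lam x n = (\<Prod>i<n. x - real i * lam)"

abbreviation ffact :: "real \<Rightarrow> nat \<Rightarrow> real" where
  "ffact x n \<equiv> deg_ffact 1 x n"

definition deg_exp :: "real \<Rightarrow> real \<Rightarrow> real fps" where
  "deg_exp lam x = Abs_fps (\<lambda>n. deg_ffact lam x n / fact n)"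

text \<open>
  \<open>deg_Stirling2 lam n\<close> is the coefficient sequence of \<open>(x)\<^sub>n\<^sub>,\<^sub>\<lambda>\<close> in the basis \<open>(x)\<^sub>k\<close>,
  extended by 0 for \<open>k > n\<close>; existence and uniqueness are proved below
  (\<open>deg_Stirling2_ex1\<close>).
\<close>

definition deg_Stirling2 :: "real \<Rightarrow> nat \<Rightarrow> nat \<Rightarrow> real" where
  "deg_Stirling2 lam n =
     (THE s. (\<forall>k>n. s k = 0) \<and> (\<forall>x. deg_ffact lam x n = (\<Sum>k\<le>n. s k * ffact x k)))"

definition deg_Bell :: "real \<Rightarrow> nat \<Rightarrow> real" where
  "deg_Bell lam n = fact n * fps_nth (fps_exp 1 oo (deg_exp lam 1 - 1)) n"

text \<open>
  The division of formal power series below is exact (\<open>trunc_deg_Bell_fps_mult\<close>), because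
  \<open>deg_exp lam 1 - 1\<close> has zero constant term and is itself nonzero.
\<close>

definition trunc_deg_Bell_fps :: "real \<Rightarrow> nat \<Rightarrow> real fps" where
  "trunc_deg_Bell_fps lam p =
     fps_const (fact p) *
       (((fps_exp 1 oo (deg_exp lam 1 - 1))
           - (\<Sum>k<p. fps_const (1 / fact k) * (deg_exp lam 1 - 1) ^ k))
        / (deg_exp lam 1 - 1) ^ p)"

definition trunc_deg_Bell :: "real \<Rightarrow> nat \<Rightarrow> nat \<Rightarrow> real" where
  "trunc_deg_Bell lam p n = fact n * fps_nth (trunc_deg_Bell_fps lam p) n"


lemma deg_ffact_0 [simp]: "deg_ffact lam x 0 = 1"
  by (simp add: deg_ffact_def)

lemma deg_ffact_Suc: "deg_ffact lam x (Suc n) = deg_ffact lam x n * (x - real n * lam)"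
  by (simp add: deg_ffact_def)

lemma ffact_of_nat_eq_0: "m < k \<Longrightarrow> ffact (real m) k = 0"
  by (auto simp: deg_ffact_def)

lemma ffact_of_nat_neq_0: "k \<le> m \<Longrightarrow> ffact (real m) k \<noteq> 0"
  by (auto simp: deg_ffact_def)

lemma ffact_expansion_unique:
  assumes "\<And>x. (\<Sum>k\<le>n. s k * ffact x k) = (\<Sum>k\<le>n. s' k * ffact x k)"
    and "m \<le> n"
  shows "s m = (s' m :: real)"
  using assms(2)
proof (induction m rule: less_induct)
  case (less m)
  have cut: "(\<Sum>k\<le>n. a k * ffact (real m) k) = (\<Sum>k<m. a k * ffact (real m) k) + a m * ffact (real m) m"
    for a :: "nat \<Rightarrow> real"
  proof -
    have "(\<Sum>k\<le>n. a k * ffact (real m) k) = (\<Sum>k\<le>m. a k * ffact (real m) k)"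
      by (rule sum.mono_neutral_right) (use less.prems in \<open>auto simp: ffact_of_nat_eq_0\<close>)
    then show ?thesis
      by (simp add: lessThan_Suc_atMost [symmetric])
  qed
  have "(\<Sum>k<m. s k * ffact (real m) k) = (\<Sum>k<m. s' k * ffact (real m) k)"
    using less by (intro sum.cong) auto
  then have "s m * ffact (real m) m = s' m * ffact (real m) m"
    using assms(1)[of "real m"] unfolding cut by linarith
  then show ?case
    using ffact_of_nat_neq_0[of m m] by simp
qed

lemma ffact_expansion_exists:
  "\<exists>s. (\<forall>k>n. s k = 0) \<and> (\<forall>x. deg_ffact lam x n = (\<Sum>k\<le>n. s k * ffact x k))"
proof (induction n)
  case 0
  show ?case
    by (rule exI[of _ "\<lambda>k. if k = 0 then 1 else 0"]) simp
next
  case (Suc n)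
  then obtain s where s0: "\<And>k. k > n \<Longrightarrow> s k = 0"
    and s: "\<And>x. deg_ffact lam x n = (\<Sum>k\<le>n. s k * ffact x k)"
    by blast
  define s' where "s' = (\<lambda>k. (if k = 0 then 0 else s (k - 1)) + (real k - real n * lam) * s k)"
  have "deg_ffact lam x (Suc n) = (\<Sum>k\<le>Suc n. s' k * ffact x k)" for x
  proof -
    have "deg_ffact lam x (Suc n) = (\<Sum>k\<le>n. s k * (ffact x k * (x - real n * lam)))"
      by (simp add: deg_ffact_Suc s sum_distrib_right mult.assoc)
    also have "\<dots> = (\<Sum>k\<le>n. s k * ffact x (Suc k) + (real k - real n * lam) * s k * ffact x k)"
      by (intro sum.cong) (auto simp: deg_ffact_Suc algebra_simps)
    also have "\<dots> = (\<Sum>k\<le>n. s k * ffact x (Suc k)) + (\<Sum>k\<le>Suc n. (real k - real n * lam) * s k * ffact x k)"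
      by (simp add: sum.distrib s0)
    also have "(\<Sum>k\<le>n. s k * ffact x (Suc k)) = (\<Sum>k\<le>Suc n. (if k = 0 then 0 else s (k - 1)) * ffact x k)"
      by (simp add: sum.atMost_Suc_shift del: sum.atMost_Suc)
    finally show ?thesis
      by (simp only: s'_def distrib_right sum.distrib)
  qed
  moreover have "s' k = 0" if "k > Suc n" for k
    using that by (auto simp: s'_def s0)
  ultimately show ?case
    by blast
qed

lemma deg_Stirling2_ex1:
  "\<exists>!s. (\<forall>k>n. s k = 0) \<and> (\<forall>x. deg_ffact lam x n = (\<Sum>k\<le>n. s k * ffact x k))"
proof (rule ex_ex1I)
  fix s s' :: "nat \<Rightarrow> real"
  assume s: "(\<forall>k>n. s k = 0) \<and> (\<forall>x. deg_ffact lam x n = (\<Sum>k\<le>n. s k * ffact x k))"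
    and s': "(\<forall>k>n. s' k = 0) \<and> (\<forall>x. deg_ffact lam x n = (\<Sum>k\<le>n. s' k * ffact x k))"
  show "s = s'"
  proof
    fix k
    show "s k = s' k"
      using s s' ffact_expansion_unique[of s n s' k] by (cases "k \<le> n") auto
  qed
qed (rule ffact_expansion_exists)

lemma deg_Stirling2_eq_0: "k > n \<Longrightarrow> deg_Stirling2 lam n k = 0"
  and deg_ffact_eq_sum_deg_Stirling2:
    "deg_ffact lam x n = (\<Sum>k\<le>n. deg_Stirling2 lam n k * ffact x k)"
  using theI'[OF deg_Stirling2_ex1[of n lam]] unfolding deg_Stirling2_def by blast+

lemma deg_exp_minus_1_nth_0: "fps_nth (deg_exp lam 1 - 1) 0 = 0"
  by (simp add: deg_exp_def)

lemma deg_exp_minus_1_neq_0: "deg_exp lam 1 - 1 \<noteq> 0"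
proof
  assume "deg_exp lam 1 - 1 = 0"
  then have "fps_nth (deg_exp lam 1 - 1) 1 = 0"
    by simp
  then show False
    by (simp add: deg_exp_def deg_ffact_Suc)
qed

lemma trunc_deg_Bell_fps_mult:
  "trunc_deg_Bell_fps lam p * (deg_exp lam 1 - 1) ^ p =
     fps_const (fact p) * ((fps_exp 1 oo (deg_exp lam 1 - 1))
       - (\<Sum>k<p. fps_const (1 / fact k) * (deg_exp lam 1 - 1) ^ k))" (is ?mult)
  and trunc_deg_Bell_fps_eq:
  "trunc_deg_Bell_fps lam p = (Abs_fps (\<lambda>k. fact p / fact (k + p)) oo (deg_exp lam 1 - 1))" (is ?eq)
proof -
  define u where "u = deg_exp lam 1 - 1"
  define G where "G = Abs_fps (\<lambda>k. 1 / fact (k + p) :: real)"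
  have u0: "fps_nth u 0 = 0" and u: "u \<noteq> 0"
    using deg_exp_minus_1_nth_0 deg_exp_minus_1_neq_0 by (auto simp: u_def)
  have "fps_exp 1 = (\<Sum>k<p. fps_const (1 / fact k) * fps_X ^ k) + G * fps_X ^ p"
  proof (rule fps_ext)
    fix n
    have "fps_nth (\<Sum>k<p. fps_const (1 / fact k) * fps_X ^ k) n
        = (\<Sum>k<p. if k = n then 1 / fact n else 0 :: real)"
      unfolding fps_sum_nth by (intro sum.cong) (auto simp: fps_X_power_iff)
    also have "\<dots> = (if n < p then 1 / fact n else 0)"
      by (simp add: sum.delta)
    finally have head: "fps_nth (\<Sum>k<p. fps_const (1 / fact k) * fps_X ^ k) n
        = (if n < p then 1 / fact n else 0 :: real)" .
    show "fps_nth (fps_exp 1) n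
        = fps_nth ((\<Sum>k<p. fps_const (1 / fact k) * fps_X ^ k) + G * fps_X ^ p) n"
      unfolding fps_add_nth head by (simp add: fps_X_power_mult_right_nth G_def)
  qed
  then have "(fps_exp 1 oo u) = (\<Sum>k<p. fps_const (1 / fact k) * u ^ k) + (G oo u) * u ^ p"
    using u0 by (simp add: fps_compose_add_distrib fps_compose_sum_distrib
        fps_compose_mult_distrib fps_compose_power[symmetric])
  then have split: "(fps_exp 1 oo u) - (\<Sum>k<p. fps_const (1 / fact k) * u ^ k) = (G oo u) * u ^ p"
    by simp
  then have "trunc_deg_Bell_fps lam p = fps_const (fact p) * (((G oo u) * u ^ p) / u ^ p)"
    by (simp only: trunc_deg_Bell_fps_def u_def)
  also have "\<dots> = fps_const (fact p) * (G oo u)"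
    using u by simp
  finally have T: "trunc_deg_Bell_fps lam p = fps_const (fact p) * (G oo u)" .
  then show ?mult
    using split by (simp add: u_def mult.assoc)
  note T
  also have "fps_const (fact p) * (G oo u) = (fps_const (fact p) * G) oo u"
    using u0 by (simp add: fps_compose_mult_distrib)
  also have "fps_const (fact p) * G = Abs_fps (\<lambda>k. fact p / fact (k + p))"
    by (rule fps_ext) (simp add: G_def)
  finally show ?eq
    by (simp add: u_def)
qed

end

theory Submission
  imports Defs
begin

text \<open>
  Put \<open>u = e\<^sub>\<lambda>(t) - 1\<close>. Both sides are coefficients of power series composed with \<open>u\<close>: since
  \<open>S\<^sub>2\<^sub>,\<^sub>\<lambda>(m, l) / m!\<close> is the coefficient of \<open>t\<^sup>m\<close> in \<open>u\<^sup>l / l!\<close>, the claim is the identity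
  \<open>\<Sum>\<^sub>k p! / (k + p)! u\<^sup>k = e\<^sup>u \<cdot> H(u)\<close> with \<open>H = \<Sum>\<^sub>l p / (p + l) (- u)\<^sup>l / l!\<close>. Both sides of it solve
  \<open>u y' + p y = p + u y\<close>, because \<open>u H' + p H = p e\<^sup>-\<^sup>u\<close>; for \<open>p \<ge> 1\<close> this equation determines all
  coefficients of \<open>y\<close>.
\<close>

text \<open>This is the recurrence \<open>deg_ffact lam 1 (Suc n) = deg_ffact lam 1 n * (1 - real n
  * lam)\<close> read as a differential equation: the part with \<open>n * lam\<close> comes from
  \<open>fps_X * fps_deriv\<close>.\<close>

lemma deg_exp_deriv:
  "(1 + fps_const lam * fps_X) * fps_deriv (deg_exp lam 1 - 1) = 1 + (deg_exp lam 1 - 1)"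
proof (rule fps_ext)
  fix n
  have *: "real (Suc n) * fps_nth (deg_exp lam 1) (Suc n) = (1 - real n * lam) * fps_nth (deg_exp lam 1) n" for n
    by (simp add: deg_exp_def deg_ffact_Suc field_simps del: of_nat_Suc)
  show "fps_nth ((1 + fps_const lam * fps_X) * fps_deriv (deg_exp lam 1 - 1)) n
      = fps_nth (1 + (deg_exp lam 1 - 1)) n"
    using *[of n] by (cases n) (simp_all add: distrib_right mult.assoc algebra_simps)
qed

text \<open>Links the definition by change of basis to the generating function: the coefficients on
  the right satisfy the triangular recurrence of the expansion in falling factorials, and that
  expansion is unique.\<close>

lemma deg_Stirling2_eq_fps_nth:
  "deg_Stirling2 lam n k = fact n * fps_nth ((deg_exp lam 1 - 1) ^ k) n / fact k"
proof -
  define u where "u = deg_exp lam 1 - 1"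
  define s where "s n k = fact n * fps_nth (u ^ k) n / fact k" for n k
  have deriv: "(1 + fps_const lam * fps_X) * fps_deriv u = 1 + u"
    by (simp only: u_def deg_exp_deriv)
  have s0: "s n k = 0" if "k > n" for n k
    using that startsby_zero_power_prefix[of u k] deg_exp_minus_1_nth_0
    by (simp add: s_def u_def)
  \<comment> \<open>Compare coefficients in
    \<open>(1 + lam t) (u^k)' = k u^(k-1) (1 + u) = k (u^(k-1) + u^k)\<close>, where
    \<open>deriv\<close> has replaced \<open>(1 + lam t) u'\<close>.\<close>
  have rec: "s (Suc n) k = (if k = 0 then 0 else s n (k - 1)) + (real k - real n * lam) * s n k" for n k
  proof (cases k)
    case 0
    then show ?thesis by (auto simp: s_def)
  next
    case (Suc j)
    have "(1 + fps_const lam * fps_X) * fps_deriv (u ^ k)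
        = fps_const (real k) * u ^ j * ((1 + fps_const lam * fps_X) * fps_deriv u)"
      by (simp only: Suc fps_deriv_power diff_Suc_1 mult_ac)
    also have "\<dots> = fps_const (real k) * (u ^ j + u ^ k)"
      unfolding deriv by (simp add: Suc algebra_simps del: of_nat_Suc)
    finally have "fps_nth ((1 + fps_const lam * fps_X) * fps_deriv (u ^ k)) n
        = fps_nth (fps_const (real k) * (u ^ j + u ^ k)) n"
      by simp
    then have "real (Suc n) * fps_nth (u ^ k) (Suc n) + real n * lam * fps_nth (u ^ k) n
        = real k * (fps_nth (u ^ j) n + fps_nth (u ^ k) n)"
      by (cases n) (simp_all add: distrib_right mult.assoc algebra_simps)
    then have "real (Suc n) * fps_nth (u ^ k) (Suc n)
        = real k * fps_nth (u ^ j) n + (real k - real n * lam) * fps_nth (u ^ k) n"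
      by (simp add: algebra_simps)
    then have "s (Suc n) k
        = fact n * (real k * fps_nth (u ^ j) n + (real k - real n * lam) * fps_nth (u ^ k) n) / fact k"
      unfolding s_def fact_Suc by (metis mult.assoc mult.commute of_nat_fact)
    also have "\<dots> = s n j + (real k - real n * lam) * s n k"
      unfolding s_def Suc fact_Suc by (simp add: field_simps del: of_nat_Suc)
    finally show ?thesis by (simp add: Suc)
  qed
  have expand: "deg_ffact lam x n = (\<Sum>k\<le>n. s n k * ffact x k)" for x n
  proof (induction n)
    case 0
    show ?case by (simp add: s_def)
  next
    case (Suc n)
    have "deg_ffact lam x (Suc n) = (\<Sum>k\<le>n. s n k * (ffact x k * (x - real n * lam)))"
      by (simp add: deg_ffact_Suc Suc sum_distrib_right mult.assoc)
    \<comment> \<open>Split \<open>x - n lam = (x - k) + (k - n lam)\<close>; the first part raises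
      \<open>ffact x k\<close> to \<open>ffact x (Suc k)\<close>.\<close>
    also have "\<dots> = (\<Sum>k\<le>n. s n k * ffact x (Suc k) + (real k - real n * lam) * s n k * ffact x k)"
      by (intro sum.cong) (auto simp: deg_ffact_Suc algebra_simps)
    \<comment> \<open>The second sum may run up to \<open>Suc n\<close> because
      \<open>s n (Suc n) = 0\<close>.\<close>
    also have "\<dots> = (\<Sum>k\<le>n. s n k * ffact x (Suc k))
        + (\<Sum>k\<le>Suc n. (real k - real n * lam) * s n k * ffact x k)"
      by (simp add: sum.distrib s0)
    also have "(\<Sum>k\<le>n. s n k * ffact x (Suc k))
        = (\<Sum>k\<le>Suc n. (if k = 0 then 0 else s n (k - 1)) * ffact x k)"
      by (simp add: sum.atMost_Suc_shift del: sum.atMost_Suc)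
    finally show ?case
      by (simp only: rec distrib_right sum.distrib)
  qed
  have "deg_Stirling2 lam n = s n"
    unfolding deg_Stirling2_def
    by (rule the1_equality[OF deg_Stirling2_ex1]) (use s0 expand in blast)
  then show ?thesis by (simp add: s_def u_def)
qed

text \<open>Stated in \<open>fps_X\<close>, before composition with \<open>u\<close>, so that the
  differential equation does not involve \<open>lam\<close>.\<close>

lemma trunc_exp_fps_eq:
  assumes "p \<ge> 1"
  shows "Abs_fps (\<lambda>k. fact p / fact (k + p)) =
    fps_exp 1 * Abs_fps (\<lambda>l. real p * (-1) ^ l / (real (p + l) * fact l))" (is "?F = _ * ?H")
proof -
  let ?P = "fps_exp 1 * ?H"
  \<comment> \<open>The operator \<open>X d/dX + p\<close> multiplies the coefficient of
    \<open>X^n\<close> by \<open>n + p\<close>, which cancels the denominator in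
    \<open>?H\<close>.\<close>
  have "fps_X * fps_deriv ?H + fps_const (real p) * ?H = fps_const (real p) * fps_exp (-1)"
  proof (rule fps_ext)
    fix n
    have "real (p + n) \<noteq> 0" using assms by simp
    then have "(real n + real p) * (real p * (-1) ^ n / (real (p + n) * fact n)) = real p * ((-1) ^ n / fact n)"
      by (simp add: add.commute)
    moreover have "fps_nth (fps_X * fps_deriv ?H) n = real n * fps_nth ?H n"
      by (cases n) (simp_all del: of_nat_Suc fact_Suc)
    ultimately show "fps_nth (fps_X * fps_deriv ?H + fps_const (real p) * ?H) n
        = fps_nth (fps_const (real p) * fps_exp (-1)) n"
      by (simp only: fps_add_nth fps_mult_left_const_nth fps_exp_nth fps_nth_Abs_fps of_nat_fact
          distrib_right[symmetric])
  qed
  then have H: "fps_X * fps_deriv ?H = fps_const (real p) * fps_exp (-1) - fps_const (real p) * ?H"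
    by (simp add: eq_diff_eq)
  have "fps_X * fps_deriv ?P = fps_X * ?P + fps_exp 1 * (fps_X * fps_deriv ?H)"
    by (simp add: algebra_simps)
  also have "\<dots> = fps_X * ?P + fps_const (real p) * (fps_exp 1 * fps_exp (-1)) - fps_const (real p) * ?P"
    unfolding H by (simp add: algebra_simps)
  also have "fps_exp 1 * fps_exp (-1) = (1 :: real fps)"
    by (simp add: fps_exp_add_mult[symmetric])
  finally have P: "fps_X * fps_deriv ?P + fps_const (real p) * ?P = fps_const (real p) + fps_X * ?P"
    by simp
  have "fps_nth ?P k = fact p / fact (k + p)" for k
  proof (induction k)
    case 0
    show ?case using assms by simp
  next
    case (Suc k)
    \<comment> \<open>The constant \<open>p\<close> in \<open>P\<close> affects only the coefficient
      of \<open>X^0\<close>, so from degree 1 on \<open>P\<close> is a first-order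
      recurrence.\<close>
    have "(real (Suc k) + real p) * fps_nth ?P (Suc k) = fps_nth ?P k"
      using arg_cong[OF P, of "\<lambda>f. fps_nth f (Suc k)"]
      by (simp add: distrib_right del: fps_mult_nth_0 fps_mult_nth_1 fps_deriv_mult of_nat_Suc)
    then have "fps_nth ?P (Suc k) = fact p / fact (k + p) / (real (Suc k) + real p)"
      unfolding Suc.IH
      by (subst nonzero_eq_divide_eq) (linarith, simp only: mult.commute)
    also have "\<dots> = fact p / fact (Suc k + p)"
      by (simp add: algebra_simps)
    finally show ?case .
  qed
  then show ?thesis by (simp add: fps_eq_iff)
qed

theorem theorem8:
  fixes lam :: real and n p :: nat
  assumes "p \<ge> 1"
  shows "trunc_deg_Bell lam p n =
    real p * (\<Sum>m=0..n. \<Sum>l=0..m.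
      real (n choose m) * ((-1) ^ l / real (p + l)) * deg_Stirling2 lam m l * deg_Bell lam (n - m))"
proof -
  define u where "u = deg_exp lam 1 - 1"
  define H where "H = Abs_fps (\<lambda>l. real p * (-1) ^ l / (real (p + l) * fact l))"
  have u0: "fps_nth u 0 = 0"
    using deg_exp_minus_1_nth_0 by (simp add: u_def)
  \<comment> \<open>The coefficient formula for composition stops at \<open>l = m\<close>, and the
    \<open>fact l\<close> in \<open>H\<close> is the one in the generating function of
    \<open>deg_Stirling2\<close>.\<close>
  have H: "fps_nth (H oo u) m
      = (\<Sum>l=0..m. real p * ((-1) ^ l / real (p + l)) * deg_Stirling2 lam m l) / fact m" for m
    by (simp add: fps_compose_nth H_def deg_Stirling2_eq_fps_nth u_def sum_divide_distrib mult.assoc)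
  \<comment> \<open>With \<open>H oo u\<close> as the left factor, the Cauchy product gives index
    \<open>m\<close> to the Stirling sum and \<open>n - m\<close> to the Bell number.\<close>
  have "trunc_deg_Bell_fps lam p = (H oo u) * (fps_exp 1 oo u)"
    using u0 by (simp add: trunc_deg_Bell_fps_eq trunc_exp_fps_eq[OF assms] fps_compose_mult_distrib
        H_def u_def mult.commute)
  then have "trunc_deg_Bell lam p n
      = (\<Sum>m=0..n. fact n * (fps_nth (H oo u) m * fps_nth (fps_exp 1 oo u) (n - m)))"
    by (simp add: trunc_deg_Bell_def fps_mult_nth sum_distrib_left)
  also have "\<dots> = (\<Sum>m=0..n. real p * (\<Sum>l=0..m.
      real (n choose m) * ((-1) ^ l / real (p + l)) * deg_Stirling2 lam m l * deg_Bell lam (n - m)))"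
  proof (rule sum.cong)
    fix m assume "m \<in> {0..n}"
    \<comment> \<open>Of the factor \<open>fact n\<close>, \<open>fact m\<close> cancels the
      denominator in \<open>H\<close>, \<open>fact (n - m)\<close> goes into
      \<open>deg_Bell\<close>, and the binomial coefficient remains.\<close>
    then have "real (n choose m) * fact (n - m) = fact n / fact m"
      by (simp add: binomial_fact)
    then have "fact n * (fps_nth (H oo u) m * fps_nth (fps_exp 1 oo u) (n - m))
        = (\<Sum>l=0..m. real p * ((-1) ^ l / real (p + l)) * deg_Stirling2 lam m l)
          * (real (n choose m) * deg_Bell lam (n - m))"
      unfolding H deg_Bell_def u_def[symmetric] by (simp add: field_simps)
    then show "fact n * (fps_nth (H oo u) m * fps_nth (fps_exp 1 oo u) (n - m)) = real p * (\<Sum>l=0..m.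
      real (n choose m) * ((-1) ^ l / real (p + l)) * deg_Stirling2 lam m l * deg_Bell lam (n - m))"
      by (simp add: sum_distrib_left sum_distrib_right mult_ac)
  qed simp
  finally show ?thesis
    by (simp add: sum_distrib_left)
qed

end
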